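(* Let $X$ be a compact Riemannian manifold and let $G\times X\to X$ be a continuous action of a finitely generated semigroup $(G,G_1)$ such that every element $g\in G_1$ acts as a local homeomorphism of $X$. If the semigroup action satisfies the strong orbital specification property, then every point of $X$ is an entropy point with respect to the topological entropy $h_{top}((G,G_1),\cdot)$; that is, for every $x\in X$ and every neighbourhood $U$ of $x$ one has $h_{top}((G,G_1),\overline U)=h_{top}((G,G_1),X)$.
   Context: Setting: $G$ is a semigroup with identity $id$ and finite generating set $G_1$ containing $id$; $G_1^*=G_1\setminus\{id\}$ and $m=|G_1^*|$. A continuous action on $X$ assigns to every $g\in G$ a continuous map $g:X\to X$, with $id$ acting as the identity and products acting as compositions. $G_n^*$ is the set of elements $g_{i_n}\cdots g_{i_1}$ with all $g_{i_j}\in G_1^*$. Local homeomorphism: a continuous $f:X\to X$ such that every $x\in X$ has an open neighbourhood $V_x$ for which $f|_{V_x}:V_x\to f(V_x)$ is a homeomorphism. Strong orbital specification property: for every $\varepsilon>0$ there is $p(\varepsilon)>0$ such that for any $k\ge1$, any $\underline h_{p_j}\in G^*_{p_j}$ with $p_j\ge p(\varepsilon)$ ($1\le j\le k$), any points $x_1,\dots,x_k\in X$, any natural numbers $n_1,\dots,n_k$ and any concatenations $\underline g_{n_j,j}=g_{i_{n_j},j}\cdots g_{i_2,j}g_{i_1,j}$ of $n_j$ elements of $G_1$ ($1\le j\le k$), there is $x\in X$ such that $d(\underline g_{\ell,1}(x),\underline g_{\ell,1}(x_1))<\varepsilon$ for $\ell=1,\dots,n_1$ and $d(\underline g_{\ell,j}\,\underline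 h_{p_{j-1}}\cdots\underline g_{n_2,2}\,\underline h_{p_1}\,\underline g_{n_1,1}(x),\underline g_{\ell,j}(x_j))<\varepsilon$ for $j=2,\dots,k$ and $\ell=1,\dots,n_j$, where $\underline g_{\ell,j}:=g_{i_\ell,j}\cdots g_{i_1,j}$. Topological entropy: for a concatenation $\underline g=g_{i_n}\cdots g_{i_1}$ of generators put $\underline g_0=id$, $\underline g_j=g_{i_j}\cdots g_{i_1}$ and $d_{\underline g}(x,y)=\max_{0\le j\le n}d(\underline g_j(x),\underline g_j(y))$ (this depends on the concatenation, not only on the resulting element). For compact $E\subset X$, $s(\underline g,n,E,\varepsilon)$ is the maximal cardinality of a set $K\subset E$ with $d_{\underline g}(x_1,x_2)>\varepsilon$ for all distinct $x_1,x_2\in K$. Set $Z_n((G,G_1),E,\varepsilon)=\frac1{m^n}\sum_{\underline g}s(\underline g,n,E,\varepsilon)$, the sum being over all $m^n$ concatenations $\underline g$ of $n$ elements of $G_1^*$, and $h_{top}((G,G_1),E)=\lim_{\varepsilon\to0}\limsup_{n\to\infty}\frac1n\log Z_n((G,G_1),E,\varepsilon)$. *)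

theory Defs
  imports "HOL-Analysis.Analysis"
begin

section \<open>Compact Riemannian manifolds\<close>

primrec Ck_on ::
  "nat \<Rightarrow> ('e::real_normed_vector \<Rightarrow> 'f::real_normed_vector) \<Rightarrow> 'e set \<Rightarrow> bool" where
  "Ck_on 0 f S \<longleftrightarrow> continuous_on S f"
| "Ck_on (Suc k) f S \<longleftrightarrow>
     (\<forall>x\<in>S. f differentiable (at x)) \<and>
     (\<forall>v. Ck_on k (\<lambda>x. frechet_derivative f (at x) v) S)"

definition smooth_on ::
  "('e::real_normed_vector \<Rightarrow> 'f::real_normed_vector) \<Rightarrow> 'e set \<Rightarrow> bool" where
  "smooth_on f S \<longleftrightarrow> (\<forall>k. Ck_on k f S)"

text \<open>A chart is a pair of its domain and its coordinate map; only the values of the coordinate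
  map on the domain matter.\<close>

type_synonym ('a, 'e) chart = "'a set \<times> ('a \<Rightarrow> 'e)"

definition transition_map :: "('a, 'e) chart \<Rightarrow> ('a, 'e) chart \<Rightarrow> 'e \<Rightarrow> 'e" where
  "transition_map c c' = snd c' \<circ> inv_into (fst c) (snd c)"

text \<open>The model space is a finite-dimensional inner product space. The class \<open>euclidean_space\<close>
  would exclude dimension 0.\<close>

definition smooth_atlas :: "('a::topological_space, 'e::real_inner) chart set \<Rightarrow> bool" where
  "smooth_atlas A \<longleftrightarrow>
     (\<exists>B::'e set. finite B \<and> span B = UNIV) \<and>
     (\<Union>c\<in>A. fst c) = UNIV \<and>
     (\<forall>(V, \<phi>)\<in>A. open V \<and> open (\<phi> ` V) \<and> (\<exists>\<psi>. homeomorphism V (\<phi> ` V) \<phi> \<psi>)) \<and>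
     (\<forall>c\<in>A. \<forall>c'\<in>A. smooth_on (transition_map c c') (snd c ` (fst c \<inter> fst c')))"

text \<open>A metric tensor is given by its coordinate expressions: \<open>g c x v w\<close> is the inner product
  at \<open>x\<close> of the tangent vectors represented by \<open>v\<close> and \<open>w\<close> in the chart \<open>c\<close>.\<close>

definition riemannian_metric ::
  "('a::topological_space, 'e::real_inner) chart set
     \<Rightarrow> (('a, 'e) chart \<Rightarrow> 'a \<Rightarrow> 'e \<Rightarrow> 'e \<Rightarrow> real) \<Rightarrow> bool" where
  "riemannian_metric A g \<longleftrightarrow>
     (\<forall>c\<in>A. \<forall>x\<in>fst c. bilinear (g c x) \<and> (\<forall>v w. g c x v w = g c x w v) \<and>
        (\<forall>v. v \<noteq> 0 \<longrightarrow> g c x v v > 0)) \<and>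
     (\<forall>c\<in>A. \<forall>v w. smooth_on (\<lambda>y. g c (inv_into (fst c) (snd c) y) v w) (snd c ` fst c)) \<and>
     (\<forall>c\<in>A. \<forall>c'\<in>A. \<forall>x\<in>fst c \<inter> fst c'.
        let D = frechet_derivative (transition_map c c') (at (snd c x))
        in \<forall>v w. g c x v w = g c' x (D v) (D w))"

definition C1_curve_on ::
  "('a::topological_space, 'e::real_inner) chart set \<Rightarrow> real set \<Rightarrow> (real \<Rightarrow> 'a) \<Rightarrow> bool" where
  "C1_curve_on A I \<gamma> \<longleftrightarrow>
     continuous_on I \<gamma> \<and>
     (\<forall>(V, \<phi>)\<in>A. \<exists>v.
        continuous_on {t\<in>I. \<gamma> t \<in> V} v \<and>
        (\<forall>t\<in>I. \<gamma> t \<in> V \<longrightarrow> ((\<phi> \<circ> \<gamma>) has_vector_derivative v t) (at t within {t\<in>I. \<gamma> t \<in> V})))"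

definition piecewise_C1_curve ::
  "('a::topological_space, 'e::real_inner) chart set \<Rightarrow> (real \<Rightarrow> 'a) \<Rightarrow> bool" where
  "piecewise_C1_curve A \<gamma> \<longleftrightarrow>
     (\<exists>N (t :: nat \<Rightarrow> real). t 0 = 0 \<and> t N = 1 \<and>
        (\<forall>i<N. t i < t (Suc i) \<and> C1_curve_on A {t i..t (Suc i)} \<gamma>))"

text \<open>The speed does not depend on the selected chart. It is meaningful except at the finitely
  many break points of a piecewise C1 curve, which the integral ignores.\<close>

definition riemannian_speed ::
  "('a::topological_space, 'e::real_inner) chart set
     \<Rightarrow> (('a, 'e) chart \<Rightarrow> 'a \<Rightarrow> 'e \<Rightarrow> 'e \<Rightarrow> real) \<Rightarrow> (real \<Rightarrow> 'a) \<Rightarrow> real \<Rightarrow> real" where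
  "riemannian_speed A g \<gamma> t =
     (let c = (SOME c. c \<in> A \<and> \<gamma> t \<in> fst c);
          v = vector_derivative (snd c \<circ> \<gamma>) (at t)
      in sqrt (g c (\<gamma> t) v v))"

definition riemannian_length ::
  "('a::topological_space, 'e::real_inner) chart set
     \<Rightarrow> (('a, 'e) chart \<Rightarrow> 'a \<Rightarrow> 'e \<Rightarrow> 'e \<Rightarrow> real) \<Rightarrow> (real \<Rightarrow> 'a) \<Rightarrow> real" where
  "riemannian_length A g \<gamma> = integral {0..1} (riemannian_speed A g \<gamma>)"

text \<open>The manifold is the whole type, its topology is that of the metric \<open>dist\<close>, and \<open>dist\<close> is the
  Riemannian distance: the infimum of the lengths of the curves joining two points. Connectedness
  is not required; between points that no curve joins, where that infimum is infinite, \<open>dist\<close> may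
  be any metric compatible with the manifold topology.\<close>

definition compact_riemannian_manifold ::
  "('a::metric_space, 'e::real_inner) chart set
     \<Rightarrow> (('a, 'e) chart \<Rightarrow> 'a \<Rightarrow> 'e \<Rightarrow> 'e \<Rightarrow> real) \<Rightarrow> bool" where
  "compact_riemannian_manifold A g \<longleftrightarrow>
     compact (UNIV :: 'a set) \<and> smooth_atlas A \<and> riemannian_metric A g \<and>
     (\<forall>x y. let C = {\<gamma>. piecewise_C1_curve A \<gamma> \<and> \<gamma> 0 = x \<and> \<gamma> 1 = y}
            in C \<noteq> {} \<longrightarrow> dist x y = (INF \<gamma>\<in>C. riemannian_length A g \<gamma>))"


section \<open>Semigroup actions\<close>

definition generating_set :: "'g::monoid_mult set \<Rightarrow> bool" where
  "generating_set G1 \<longleftrightarrow>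
     finite G1 \<and> 1 \<in> G1 \<and> (\<forall>g. \<exists>gs. set gs \<subseteq> G1 \<and> g = prod_list gs)"

definition continuous_action :: "('g::monoid_mult \<Rightarrow> 'a::topological_space \<Rightarrow> 'a) \<Rightarrow> bool" where
  "continuous_action act \<longleftrightarrow>
     act 1 = id \<and> (\<forall>g h. act (g * h) = act g \<circ> act h) \<and> (\<forall>g. continuous_on UNIV (act g))"

definition local_homeomorphism :: "('a::topological_space \<Rightarrow> 'a) \<Rightarrow> bool" where
  "local_homeomorphism f \<longleftrightarrow>
     continuous_on UNIV f \<and>
     (\<forall>x. \<exists>V. open V \<and> x \<in> V \<and> (\<exists>f'. homeomorphism V (f ` V) f f'))"

text \<open>A concatenation is a list of generators in the order in which they are applied:
  \<open>[g1, \<dots>, gn]\<close> stands for the element \<open>gn * \<dots> * g1\<close>.\<close>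

definition word_elt :: "'g::monoid_mult list \<Rightarrow> 'g" where
  "word_elt w = prod_list (rev w)"

definition words :: "'g set \<Rightarrow> nat \<Rightarrow> 'g list set" where
  "words S n = {w. length w = n \<and> set w \<subseteq> S}"

definition star_elements :: "'g::monoid_mult set \<Rightarrow> nat \<Rightarrow> 'g set" where
  "star_elements G1 n = word_elt ` words (G1 - {1}) n"

text \<open>With blocks \<open>w 1, w 2, \<dots>\<close> and gaps \<open>h 1, h 2, \<dots>\<close>, the element \<open>spec_prefix w h i\<close> is
  \<open>h i * word_elt (w i) * \<dots> * h 1 * word_elt (w 1)\<close>.\<close>

primrec spec_prefix ::
  "(nat \<Rightarrow> 'g::monoid_mult list) \<Rightarrow> (nat \<Rightarrow> 'g) \<Rightarrow> nat \<Rightarrow> 'g" where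
  "spec_prefix w h 0 = 1"
| "spec_prefix w h (Suc i) = h (Suc i) * word_elt (w (Suc i)) * spec_prefix w h i"

definition strong_orbital_specification ::
  "'g::monoid_mult set \<Rightarrow> ('g \<Rightarrow> 'a::metric_space \<Rightarrow> 'a) \<Rightarrow> bool" where
  "strong_orbital_specification G1 act \<longleftrightarrow>
     (\<forall>\<epsilon>>0. \<exists>p::nat. p > 0 \<and>
        (\<forall>k\<ge>1. \<forall>(q :: nat \<Rightarrow> nat) h (z :: nat \<Rightarrow> 'a) (n :: nat \<Rightarrow> nat) w.
           (\<forall>j\<in>{1..k}. q j \<ge> p \<and> h j \<in> star_elements G1 (q j) \<and>
                       n j \<ge> 1 \<and> w j \<in> words G1 (n j)) \<longrightarrow>
           (\<exists>x. \<forall>j\<in>{1..k}. \<forall>l\<in>{1..n j}.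
              dist (act (word_elt (take l (w j)) * spec_prefix w h (j - 1)) x)
                   (act (word_elt (take l (w j))) (z j)) < \<epsilon>)))"


section \<open>Topological entropy\<close>

definition word_dist ::
  "('g::monoid_mult \<Rightarrow> 'a::metric_space \<Rightarrow> 'a) \<Rightarrow> 'g list \<Rightarrow> 'a \<Rightarrow> 'a \<Rightarrow> real" where
  "word_dist act w x y =
     (MAX j\<in>{0..length w}. dist (act (word_elt (take j w)) x) (act (word_elt (take j w)) y))"

definition max_separated ::
  "('g::monoid_mult \<Rightarrow> 'a::metric_space \<Rightarrow> 'a) \<Rightarrow> 'g list \<Rightarrow> 'a set \<Rightarrow> real \<Rightarrow> nat" where
  "max_separated act w E \<epsilon> =
     Max {card K |K. finite K \<and> K \<subseteq> E \<and> (\<forall>x\<in>K. \<forall>y\<in>K. x \<noteq> y \<longrightarrow> word_dist act w x y > \<epsilon>)}"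

definition mean_separated ::
  "'g::monoid_mult set \<Rightarrow> ('g \<Rightarrow> 'a::metric_space \<Rightarrow> 'a) \<Rightarrow> nat \<Rightarrow> 'a set \<Rightarrow> real \<Rightarrow> real" where
  "mean_separated G1 act n E \<epsilon> =
     1 / real (card (G1 - {1})) ^ n *
       (\<Sum>w\<in>words (G1 - {1}) n. real (max_separated act w E \<epsilon>))"

definition semigroup_entropy ::
  "'g::monoid_mult set \<Rightarrow> ('g \<Rightarrow> 'a::metric_space \<Rightarrow> 'a) \<Rightarrow> 'a set \<Rightarrow> ereal" where
  "semigroup_entropy G1 act E =
     Lim (at_right 0)
       (\<lambda>\<epsilon>. limsup (\<lambda>n. ereal (1 / real n * ln (mean_separated G1 act n E \<epsilon>))))"

definition entropy_point ::
  "'g::monoid_mult set \<Rightarrow> ('g \<Rightarrow> 'a::metric_space \<Rightarrow> 'a) \<Rightarrow> 'a \<Rightarrow> bool" where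
  "entropy_point G1 act x \<longleftrightarrow>
     (\<forall>U. x \<in> interior U \<longrightarrow>
        semigroup_entropy G1 act (closure U) = semigroup_entropy G1 act UNIV)"

end

(* By specification with first block [1] and second block 1 # w, every word v of length p
   (the gap) and every point y admit a point a close to x such that act (word_elt v) a shadows the
   w-orbit of y, including time 0. Hence a (w, 2e + e')-separated set of X yields, for every v, a
   (v @ w, e')-separated set of the same cardinality near x. Averaging over v and w gives
   Z_n(X, 2e + e') <= Z_(p+n)(U, e'), and the shift by p disappears in the growth rate. *)
theory Submission
  imports Defs
begin

section \<open>Words, distances along orbits and separated sets\<close>

lemma word_elt_Nil [simp]: "word_elt [] = 1"
  by (simp add: word_elt_def)

lemma word_elt_Cons_one [simp]: "word_elt (1 # w) = word_elt w"
  by (simp add: word_elt_def)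

lemma word_elt_append: "word_elt (v @ w) = word_elt w * word_elt v"
  by (simp add: word_elt_def)

lemma finite_words: "finite S \<Longrightarrow> finite (words S n)"
  unfolding words_def using finite_lists_length_eq[of S n] by (simp add: conj_commute)

lemma card_words: "finite S \<Longrightarrow> card (words S n) = card S ^ n"
  unfolding words_def using card_lists_length_eq[of S n] by (simp add: conj_commute)

lemma word_dist_gt_iff:
  "word_dist act w x y > \<epsilon> \<longleftrightarrow>
     (\<exists>j\<le>length w. dist (act (word_elt (take j w)) x) (act (word_elt (take j w)) y) > \<epsilon>)"
  unfolding word_dist_def by (subst Max_gr_iff) auto

definition separated ::
  "('g::monoid_mult \<Rightarrow> 'a::metric_space \<Rightarrow> 'a) \<Rightarrow> 'g list \<Rightarrow> 'a set \<Rightarrow> real \<Rightarrow> 'a set \<Rightarrow> bool" where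
  "separated act w E \<epsilon> K \<longleftrightarrow>
     finite K \<and> K \<subseteq> E \<and> (\<forall>x\<in>K. \<forall>y\<in>K. x \<noteq> y \<longrightarrow> word_dist act w x y > \<epsilon>)"

lemma max_separated_eq: "max_separated act w E \<epsilon> = Max {card K |K. separated act w E \<epsilon> K}"
  by (simp add: max_separated_def separated_def)

lemma separated_mono:
  assumes "separated act w E \<epsilon> K" "E \<subseteq> F" "\<delta> \<le> \<epsilon>"
  shows "separated act w F \<delta> K"
  using assms unfolding separated_def by fastforce

text \<open>Makes the \<open>Max\<close> in \<open>max_separated\<close> meaningful. By compactness
  finitely many of the sets \<open>V c\<close>, the open balls of radius
  \<open>\<epsilon> / 2\<close> for the distance along \<open>w\<close>, cover the space. A
  separated set has at most one point in each of them, so its cardinality is at most their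
  number.\<close>

lemma finite_separated_cards:
  fixes act :: "'g::monoid_mult \<Rightarrow> 'a::metric_space \<Rightarrow> 'a"
  assumes "compact (UNIV :: 'a set)" "\<And>g. continuous_on UNIV (act g)" "\<epsilon> > 0"
  shows "finite {card K |K. separated act w E \<epsilon> K}"
proof -
  define f where "f j = act (word_elt (take j w))" for j
  define V where "V c = (\<Inter>j\<in>{..length w}. {y. dist (f j y) (f j c) < \<epsilon> / 2})" for c
  have cont: "continuous_on UNIV (f j)" for j
    unfolding f_def by (rule assms)
  have V_open: "open (V c)" for c
    unfolding V_def
    by (intro open_INT finite_atMost ballI open_Collect_less continuous_intros cont)
  have "c \<in> V c" for c
    using assms(3) by (simp add: V_def)
  then have "UNIV \<subseteq> (\<Union>c. V c)"
    by (intro subsetI UN_I[OF UNIV_I])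
  then obtain C where C: "finite C" "UNIV \<subseteq> (\<Union>c\<in>C. V c)"
    by (rule compactE_image[OF assms(1) V_open])
  have "y \<in> (\<Union>c\<in>C. V c)" for y
    using C(2) by (rule subsetD) simp
  then have "\<exists>c. c \<in> C \<and> y \<in> V c" for y
    unfolding UN_iff Bex_def .
  then obtain c where c: "\<And>y. c y \<in> C" "\<And>y. y \<in> V (c y)"
    by metis
  have "card K \<le> card C" if K: "separated act w E \<epsilon> K" for K
  proof (rule card_inj_on_le[where f = c])
    show "inj_on c K"
    proof (rule inj_onI, rule ccontr)
      fix x y assume xy: "x \<in> K" "y \<in> K" "c x = c y" "x \<noteq> y"
      then obtain j where j: "j \<le> length w" "dist (f j x) (f j y) > \<epsilon>"
        using K unfolding separated_def f_def word_dist_gt_iff by blast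
      have "dist (f j x) (f j (c x)) < \<epsilon> / 2" "dist (f j y) (f j (c x)) < \<epsilon> / 2"
        using c(2)[of x] c(2)[of y] j(1) xy(3) by (auto simp: V_def)
      then have "dist (f j x) (f j y) < \<epsilon>"
        by (rule dist_triangle_half_l)
      with j(2) show False
        by simp
    qed
  qed (use c(1) C(1) in auto)
  then show ?thesis
    by (intro finite_subset[OF _ finite_atMost[of "card C"]]) auto
qed

section \<open>Separated-set counts for an action on a compact space\<close>

locale compact_action =
  fixes G1 :: "'g::monoid_mult set"
    and act :: "'g \<Rightarrow> 'a::metric_space \<Rightarrow> 'a"
  assumes compact_UNIV: "compact (UNIV :: 'a set)"
    and finite_generators: "finite G1"
    and one_generator: "1 \<in> G1"
    and continuous_action: "continuous_action act"
begin

lemma act_one [simp]: "act 1 x = x"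
  using continuous_action by (simp add: continuous_action_def)

lemma act_mult: "act (g * h) x = act g (act h x)"
  using continuous_action by (simp add: continuous_action_def)

lemma finite_cards: "\<epsilon> > 0 \<Longrightarrow> finite {card K |K. separated act w E \<epsilon> K}"
  using continuous_action finite_separated_cards[OF compact_UNIV, of act \<epsilon> w E]
  by (simp add: continuous_action_def)

lemma card_le_max_separated:
  assumes "separated act w E \<epsilon> K" "\<epsilon> > 0"
  shows "card K \<le> max_separated act w E \<epsilon>"
  unfolding max_separated_eq using assms by (intro Max_ge finite_cards) auto

lemma max_separated_attained:
  assumes "\<epsilon> > 0"
  obtains K where "separated act w E \<epsilon> K" "card K = max_separated act w E \<epsilon>"
proof -
  \<comment> \<open>The empty set shows that the maximum is taken over a nonempty set of
    cardinalities.\<close>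
  have "separated act w E \<epsilon> {}"
    by (simp add: separated_def)
  then have "max_separated act w E \<epsilon> \<in> {card K |K. separated act w E \<epsilon> K}"
    unfolding max_separated_eq using assms by (intro Max_in finite_cards) auto
  then show ?thesis
    using that by force
qed

lemma max_separated_mono:
  assumes "0 < \<delta>" "\<delta> \<le> \<epsilon>" "E \<subseteq> F"
  shows "max_separated act w E \<epsilon> \<le> max_separated act w F \<delta>"
proof -
  obtain K where "separated act w E \<epsilon> K" "card K = max_separated act w E \<epsilon>"
    using max_separated_attained[of \<epsilon>] assms(1,2) by auto
  then show ?thesis
    using card_le_max_separated[OF separated_mono assms(1)] assms by metis
qed

lemma max_separated_pos:
  assumes "\<epsilon> > 0" "x \<in> E"
  shows "max_separated act w E \<epsilon> \<ge> 1"
proof -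
  have "separated act w E \<epsilon> {x}"
    using assms by (simp add: separated_def)
  from card_le_max_separated[OF this assms(1)] show ?thesis by simp
qed

lemma mean_separated_mono:
  assumes "0 < \<delta>" "\<delta> \<le> \<epsilon>" "E \<subseteq> F"
  shows "mean_separated G1 act n E \<epsilon> \<le> mean_separated G1 act n F \<delta>"
  unfolding mean_separated_def
  using max_separated_mono[OF assms] by (intro mult_left_mono sum_mono) auto

text \<open>Allows \<open>ln_mono\<close> to be applied to these means. A generator other than 1
  makes the set of words nonempty, and a point of \<open>E\<close> gives every word a separated
  singleton.\<close>

lemma mean_separated_pos:
  assumes "G1 - {1} \<noteq> {}" "\<epsilon> > 0" "x \<in> E"
  shows "mean_separated G1 act n E \<epsilon> > 0"
proof -
  have m: "card (G1 - {1}) > 0"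
    using assms(1) finite_generators by (simp add: card_gt_0_iff)
  then have "card (words (G1 - {1}) n) > 0"
    using finite_generators by (simp add: card_words)
  then have "words (G1 - {1}) n \<noteq> {}"
    by auto
  then have "(\<Sum>w\<in>words (G1 - {1}) n. real (max_separated act w E \<epsilon>)) > 0"
    using max_separated_pos[OF assms(2,3)] finite_generators
    by (intro sum_pos finite_words) (auto simp: Suc_le_eq)
  with m show ?thesis
    by (simp add: mean_separated_def)
qed

section \<open>Growth rates at a fixed scale\<close>

definition growth :: "'a set \<Rightarrow> real \<Rightarrow> ereal" where
  "growth E \<epsilon> = limsup (\<lambda>n. ereal (1 / real n * ln (mean_separated G1 act n E \<epsilon>)))"

text \<open>Default values decide this degenerate case. For \<open>n > 0\<close> there are no words,
  so the mean is 0 and \<open>ln 0 = 0\<close>; for \<open>n = 0\<close> the factor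
  \<open>1 / real n\<close> is 0.\<close>

lemma mean_separated_trivial:
  assumes "G1 - {1} = {}"
  shows "1 / real n * ln (mean_separated G1 act n E \<epsilon>) = 0"
  by (cases "n = 0") (auto simp: mean_separated_def words_def assms zero_power)

lemma growth_mono:
  assumes "0 < \<delta>" "\<delta> \<le> \<epsilon>" "E \<subseteq> F" "x \<in> E"
  shows "growth E \<epsilon> \<le> growth F \<delta>"
proof (cases "G1 - {1} = {}")
  case True
  then show ?thesis
    by (simp only: growth_def mean_separated_trivial order_refl)
next
  case False
  have "ln (mean_separated G1 act n E \<epsilon>) \<le> ln (mean_separated G1 act n F \<delta>)" for n
    using assms mean_separated_pos[OF False, of \<epsilon> x E n] mean_separated_mono[OF assms(1-3), of n]
    by (intro ln_mono) auto
  then show ?thesis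
    unfolding growth_def
    by (intro Limsup_mono always_eventually allI) (auto intro!: divide_right_mono)
qed

text \<open>By \<open>growth_mono\<close> the rate can only increase as the scale shrinks, so its
  one-sided limit exists and is the supremum. Thus the \<open>Lim\<close> in
  \<open>semigroup_entropy\<close> is a genuine limit.\<close>

lemma tendsto_growth:
  assumes "x \<in> E"
  shows "(growth E \<longlongrightarrow> (SUP \<epsilon>\<in>{0<..}. growth E \<epsilon>)) (at_right 0)"
proof (rule order_tendstoI)
  fix a assume "a < (SUP \<epsilon>\<in>{0<..}. growth E \<epsilon>)"
  then obtain \<epsilon> where \<epsilon>: "\<epsilon> > 0" "a < growth E \<epsilon>"
    by (auto simp: less_SUP_iff)
  have "a < growth E \<delta>" if "0 < \<delta>" "\<delta> < \<epsilon>" for \<delta>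
    using \<epsilon> growth_mono[of \<delta> \<epsilon> E E x] that assms by (auto intro: less_le_trans)
  then show "eventually (\<lambda>\<delta>. a < growth E \<delta>) (at_right 0)"
    using \<epsilon>(1) by (auto simp: eventually_at_right_field)
next
  fix a assume a: "(SUP \<epsilon>\<in>{0<..}. growth E \<epsilon>) < a"
  have "growth E \<delta> < a" if "0 < \<delta>" for \<delta>
    using that by (intro le_less_trans[OF SUP_upper a]) auto
  then show "eventually (\<lambda>\<delta>. growth E \<delta> < a) (at_right 0)"
    by (auto simp: eventually_at_right_field intro: exI[of _ 1])
qed

section \<open>Transfer of separated sets by shadowing\<close>

text \<open>Each point of a maximal separated set is replaced by a point of \<open>E\<close> that
  shadows it after \<open>v\<close>. A distance between two orbits loses at most \<epsilon> at
  either end, hence the scale \<open>2 * \<epsilon> + \<delta>\<close>.\<close>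

lemma max_separated_le_shadowing:
  assumes "\<epsilon> > 0" "\<delta> > 0"
    and shadow: "\<And>y. \<exists>a\<in>E. \<forall>j\<le>length w.
      dist (act (word_elt (take j w) * word_elt v) a) (act (word_elt (take j w)) y) < \<epsilon>"
  shows "max_separated act w UNIV (2 * \<epsilon> + \<delta>) \<le> max_separated act (v @ w) E \<delta>"
proof -
  obtain K where K: "separated act w UNIV (2 * \<epsilon> + \<delta>) K"
    "card K = max_separated act w UNIV (2 * \<epsilon> + \<delta>)"
    using max_separated_attained[of "2 * \<epsilon> + \<delta>"] assms(1,2) by auto
  define f where "f j = act (word_elt (take j w))" for j
  have "\<exists>a. a \<in> E \<and> (\<forall>j\<le>length w. dist (f j (act (word_elt v) a)) (f j y) < \<epsilon>)" for y
    using shadow[of y] by (auto simp: f_def act_mult)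
  then obtain a where a: "\<And>y. a y \<in> E"
    "\<And>y j. j \<le> length w \<Longrightarrow> dist (f j (act (word_elt v) (a y))) (f j y) < \<epsilon>"
    by metis
  have sep: "word_dist act (v @ w) (a y) (a z) > \<delta>" if yz: "y \<in> K" "z \<in> K" "y \<noteq> z" for y z
  proof -
    obtain j where j: "j \<le> length w" "dist (f j y) (f j z) > 2 * \<epsilon> + \<delta>"
      using K(1) yz unfolding separated_def word_dist_gt_iff f_def by blast
    define b where "b u = f j (act (word_elt v) (a u))" for u
    have "dist (f j y) (f j z) \<le> dist (b y) (f j y) + dist (b y) (b z) + dist (b z) (f j z)"
      using dist_triangle[of "f j y" "f j z" "b y"] dist_triangle[of "b y" "f j z" "b z"]
      by (simp add: dist_commute)
    with j a(2)[OF j(1), of y] a(2)[OF j(1), of z] have "dist (b y) (b z) > \<delta>"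
      by (simp add: b_def)
    \<comment> \<open>Time \<open>j\<close> along \<open>w\<close> is time
      \<open>length v + j\<close> along \<open>v @ w\<close>, so the separation is seen by the
      longer word.\<close>
    moreover have "b u = act (word_elt (take (length v + j) (v @ w))) (a u)" for u
      by (simp add: b_def f_def word_elt_append act_mult)
    ultimately show ?thesis
      unfolding word_dist_gt_iff using j(1) by (intro exI[of _ "length v + j"]) auto
  qed
  \<comment> \<open>Distinct points have distinct shadowing points, since equal ones would be at
    distance 0; so no cardinality is lost.\<close>
  have "word_dist act (v @ w) u u = 0" for u
    by (simp add: word_dist_def)
  with sep assms(2) have inj: "inj_on a K"
    by (metis inj_onI less_asym')
  have "separated act (v @ w) E \<delta> (a ` K)"
    using K(1) a(1) sep by (auto simp: separated_def)
  from card_le_max_separated[OF this assms(2)] show ?thesis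
    using K(2) inj by (simp add: card_image)
qed

text \<open>Summation of the previous bound over all pairs \<open>(v, w)\<close>. The left side does
  not depend on \<open>v\<close>, so it picks up the factor \<open>?m ^ p\<close>, which the
  normalisation by \<open>?m ^ (p + n)\<close> on the right absorbs.\<close>

lemma mean_separated_le_shadowing:
  assumes "\<epsilon> > 0" "\<delta> > 0" "G1 - {1} \<noteq> {}"
    and shadow: "\<And>v w y. \<lbrakk>v \<in> words (G1 - {1}) p; w \<in> words (G1 - {1}) n\<rbrakk> \<Longrightarrow> \<exists>a\<in>E. \<forall>j\<le>length w.
      dist (act (word_elt (take j w) * word_elt v) a) (act (word_elt (take j w)) y) < \<epsilon>"
  shows "mean_separated G1 act n UNIV (2 * \<epsilon> + \<delta>) \<le> mean_separated G1 act (p + n) E \<delta>"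
proof -
  let ?W = "words (G1 - {1})" and ?m = "real (card (G1 - {1}))"
  let ?app = "\<lambda>(v, w). v @ w"
  have fin: "finite (?W k)" for k
    using finite_generators by (simp add: finite_words)
  have m: "?m > 0"
    using assms(3) finite_generators by (simp add: card_gt_0_iff)
  have inj: "inj_on ?app (?W p \<times> ?W n)"
    by (auto simp: inj_on_def words_def)
  have "?m ^ p * (\<Sum>w\<in>?W n. real (max_separated act w UNIV (2 * \<epsilon> + \<delta>)))
      = (\<Sum>v\<in>?W p. \<Sum>w\<in>?W n. real (max_separated act w UNIV (2 * \<epsilon> + \<delta>)))"
    using finite_generators by (simp add: card_words)
  also have "\<dots> \<le> (\<Sum>v\<in>?W p. \<Sum>w\<in>?W n. real (max_separated act (v @ w) E \<delta>))"
    using assms(1,2) shadow by (intro sum_mono of_nat_mono max_separated_le_shadowing) auto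
  also have "\<dots> = (\<Sum>u\<in>?app ` (?W p \<times> ?W n). real (max_separated act u E \<delta>))"
    by (subst sum.reindex[OF inj]) (simp add: sum.cartesian_product split_def)
  \<comment> \<open>Every \<open>v @ w\<close> is a word of length \<open>p + n\<close>; as the
    terms are nonnegative, this inclusion suffices.\<close>
  also have "\<dots> \<le> (\<Sum>u\<in>?W (p + n). real (max_separated act u E \<delta>))"
    by (intro sum_mono2 fin) (auto simp: words_def)
  finally show ?thesis
    using m by (simp add: mean_separated_def power_add field_simps)
qed

text \<open>Passing from the factor \<open>1 / n\<close> to \<open>1 / (n + p)\<close> multiplies by
  \<open>?c n\<close>, which tends to 1 because \<open>p\<close> is fixed. A limsup is unchanged by
  such a factor and by an index shift.\<close>

lemma growth_le_shifted:
  assumes pos: "\<And>n. 0 < mean_separated G1 act n F \<delta>"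
    and le: "\<And>n. mean_separated G1 act n F \<delta> \<le> mean_separated G1 act (p + n) E \<epsilon>"
  shows "growth F \<delta> \<le> growth E \<epsilon>"
proof -
  let ?c = "\<lambda>n. real n / real (n + p)"
  let ?a = "\<lambda>n. 1 / real n * ln (mean_separated G1 act n F \<delta>)"
  let ?b = "\<lambda>n. 1 / real n * ln (mean_separated G1 act n E \<epsilon>)"
  have "(\<lambda>n. 1 - real p / real (n + p)) \<longlonglongrightarrow> 1 - 0"
    by (intro tendsto_diff tendsto_const LIMSEQ_ignore_initial_segment[OF lim_const_over_n])
  \<comment> \<open>The start at 1 avoids \<open>n = p = 0\<close>, where the right side is
    \<open>0 / 0 = 0\<close> and the left side is 1.\<close>
  moreover have "eventually (\<lambda>n. 1 - real p / real (n + p) = ?c n) sequentially"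
    by (intro eventually_sequentiallyI[of 1]) (simp add: field_simps)
  ultimately have "?c \<longlonglongrightarrow> 1"
    by (simp add: tendsto_cong)
  then have "limsup (\<lambda>n. ereal (?c n) * ereal (?a n)) = 1 * growth F \<delta>"
    unfolding growth_def one_ereal_def by (intro ereal_limsup_lim_mult) auto
  moreover have "?c n * ?a n \<le> ?b (n + p)" if "n \<ge> 1" for n
  proof -
    have "ln (mean_separated G1 act n F \<delta>) \<le> ln (mean_separated G1 act (n + p) E \<epsilon>)"
      using pos[of n] le[of n] by (intro ln_mono) (auto simp: add.commute)
    with that show ?thesis
      by (auto simp: intro: divide_right_mono)
  qed
  then have "limsup (\<lambda>n. ereal (?c n) * ereal (?a n)) \<le> limsup (\<lambda>n. ereal (?b (n + p)))"
    by (intro Limsup_mono eventually_sequentiallyI[of 1]) auto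
  moreover have "limsup (\<lambda>n. ereal (?b (n + p))) = growth E \<epsilon>"
    unfolding growth_def by (rule limsup_shift_k)
  ultimately show ?thesis by simp
qed

section \<open>From specification to entropy points\<close>

text \<open>Specification only controls times \<open>l \<ge> 1\<close>. A leading 1 in each block
  turns its first controlled time into the start of the orbit: block \<open>[1]\<close> places
  \<open>a\<close> near \<open>x\<close>, and block \<open>1 # w\<close> shadows \<open>y\<close>
  from time 0 on. The gap length \<open>p\<close> depends on \<epsilon> alone, so it serves all
  \<open>v\<close>, \<open>w\<close>, \<open>x\<close> and \<open>y\<close>.\<close>

lemma specification_two_blocks:
  assumes "strong_orbital_specification G1 act" "\<epsilon> > 0"
  obtains p where "\<And>v w x y. \<lbrakk>v \<in> words (G1 - {1}) p; set w \<subseteq> G1\<rbrakk> \<Longrightarrow>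
    \<exists>a. dist a x < \<epsilon> \<and> (\<forall>j\<le>length w.
      dist (act (word_elt (take j w) * word_elt v) a) (act (word_elt (take j w)) y) < \<epsilon>)"
proof -
  obtain p :: nat where p: "\<And>k q h z n w. \<lbrakk>k \<ge> 1; \<forall>j\<in>{1..k}. q j \<ge> p \<and>
      h j \<in> star_elements G1 (q j) \<and> n j \<ge> 1 \<and> w j \<in> words G1 (n j)\<rbrakk> \<Longrightarrow>
      \<exists>x. \<forall>j\<in>{1..k}. \<forall>l\<in>{1..n j}.
        dist (act (word_elt (take l (w j)) * spec_prefix w h (j - 1)) x)
             (act (word_elt (take l (w j))) (z j)) < \<epsilon>"
    using assms unfolding strong_orbital_specification_def by metis
  show thesis
  proof (rule that)
    fix v w :: "'g list" and x y :: 'a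
    assume v: "v \<in> words (G1 - {1}) p" and w: "set w \<subseteq> G1"
    define W where "W j = (if j = (1::nat) then [1] else 1 # w)" for j
    define z where "z j = (if j = (1::nat) then x else y)" for j
    \<comment> \<open>All gaps are the element of \<open>v\<close>, with the minimal length
      \<open>p\<close>. The prefix before the second block is then
      \<open>word_elt v * word_elt [1]\<close>, that is, \<open>word_elt v\<close>.\<close>
    have "\<forall>j\<in>{1..2}. p \<ge> p \<and> word_elt v \<in> star_elements G1 p \<and>
        length (W j) \<ge> 1 \<and> W j \<in> words G1 (length (W j))"
      using v w one_generator by (auto simp: W_def words_def star_elements_def)
    from p[OF _ this, of z] obtain a where a: "\<forall>j\<in>{1..2}. \<forall>l\<in>{1..length (W j)}.
        dist (act (word_elt (take l (W j)) * spec_prefix W (\<lambda>_. word_elt v) (j - 1)) a)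
             (act (word_elt (take l (W j))) (z j)) < \<epsilon>"
      by auto
    have "dist a x < \<epsilon>"
      using bspec[OF bspec[OF a, of 1], of 1] by (simp add: W_def z_def)
    \<comment> \<open>Time \<open>Suc j\<close> of \<open>1 # w\<close> is time \<open>j\<close> of
      \<open>w\<close>.\<close>
    moreover have "dist (act (word_elt (take j w) * word_elt v) a) (act (word_elt (take j w)) y) < \<epsilon>"
      if "j \<le> length w" for j
      using bspec[OF bspec[OF a, of 2], of "Suc j"] that by (simp add: W_def z_def numeral_2_eq_2)
    ultimately show "\<exists>a. dist a x < \<epsilon> \<and> (\<forall>j\<le>length w.
        dist (act (word_elt (take j w) * word_elt v) a) (act (word_elt (take j w)) y) < \<epsilon>)"
      by blast
  qed
qed

text \<open>The shadowing accuracy \<epsilon> is also the radius of the ball in \<open>E\<close>, so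
  all shadowing points lie in \<open>E\<close>. The gap \<open>p\<close> is chosen before
  \<open>n\<close>, as \<open>growth_le_shifted\<close> requires.\<close>

lemma growth_UNIV_le:
  assumes "strong_orbital_specification G1 act" "\<epsilon> > 0" "\<delta> > 0" "ball x \<epsilon> \<subseteq> E"
  shows "growth UNIV (2 * \<epsilon> + \<delta>) \<le> growth E \<delta>"
proof (cases "G1 - {1} = {}")
  case True
  then show ?thesis
    by (simp only: growth_def mean_separated_trivial order_refl)
next
  case False
  obtain p where p: "\<And>v w x y. \<lbrakk>v \<in> words (G1 - {1}) p; set w \<subseteq> G1\<rbrakk> \<Longrightarrow>
    \<exists>a. dist a x < \<epsilon> \<and> (\<forall>j\<le>length w.
      dist (act (word_elt (take j w) * word_elt v) a) (act (word_elt (take j w)) y) < \<epsilon>)"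
    using specification_two_blocks[OF assms(1,2)] by metis
  show ?thesis
  proof (rule growth_le_shifted)
    show "0 < mean_separated G1 act n UNIV (2 * \<epsilon> + \<delta>)" for n
      using assms(2,3) by (intro mean_separated_pos[OF False]) auto
    show "mean_separated G1 act n UNIV (2 * \<epsilon> + \<delta>) \<le> mean_separated G1 act (p + n) E \<delta>" for n
    proof (rule mean_separated_le_shadowing[OF assms(2,3) False])
      fix v w and y :: 'a
      assume vw: "v \<in> words (G1 - {1}) p" "w \<in> words (G1 - {1}) n"
      then have "set w \<subseteq> G1"
        by (auto simp: words_def)
      from p[OF vw(1) this, of x y] assms(4)
      show "\<exists>a\<in>E. \<forall>j\<le>length w.
          dist (act (word_elt (take j w) * word_elt v) a) (act (word_elt (take j w)) y) < \<epsilon>"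
        by (auto simp: subset_iff dist_commute)
    qed
  qed
qed

text \<open>The growth rate of \<open>closure U\<close> at scale \<epsilon> is squeezed between
  those of the whole space at scales \<open>3 * \<epsilon>\<close> and \<epsilon>, which have the
  same limit as \<epsilon> tends to 0.\<close>

theorem entropy_point_if_specification:
  assumes "strong_orbital_specification G1 act"
  shows "entropy_point G1 act x"
  unfolding entropy_point_def
proof (intro allI impI)
  fix U assume "x \<in> interior U"
  then obtain r where r: "r > 0" "ball x r \<subseteq> closure U"
    using closure_subset by (meson mem_interior order_trans)
  have x: "x \<in> closure U"
    using r by force
  let ?L = "SUP \<epsilon>\<in>{0<..}. growth UNIV \<epsilon>"
  have lim: "(growth UNIV \<longlongrightarrow> ?L) (at_right 0)"
    by (rule tendsto_growth) simp
  have "filterlim (\<lambda>\<epsilon>::real. 3 * \<epsilon>) (at_right 0) (at_right 0)"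
    by (auto simp: filterlim_at eventually_at_right_field intro!: tendsto_eq_intros exI[of _ 1])
  from filterlim_compose[OF lim this]
  have lim3: "((\<lambda>\<epsilon>. growth UNIV (3 * \<epsilon>)) \<longlongrightarrow> ?L) (at_right 0)" .
  \<comment> \<open>This is \<open>growth_UNIV_le\<close> with \<open>\<delta> = \<epsilon>\<close>;
    the bound \<open>\<epsilon> < r\<close> keeps the ball of radius \<epsilon> inside
    \<open>closure U\<close>.\<close>
  have "growth UNIV (3 * \<epsilon>) \<le> growth (closure U) \<epsilon>" if "0 < \<epsilon>" "\<epsilon> < r" for \<epsilon>
    using growth_UNIV_le[OF assms that(1,1), of x "closure U"] that r by force
  then have lower: "eventually (\<lambda>\<epsilon>. growth UNIV (3 * \<epsilon>) \<le> growth (closure U) \<epsilon>) (at_right 0)"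
    using r(1) by (auto simp: eventually_at_right_field)
  have upper: "eventually (\<lambda>\<epsilon>. growth (closure U) \<epsilon> \<le> growth UNIV \<epsilon>) (at_right 0)"
    using growth_mono[OF _ order_refl subset_UNIV x]
    by (auto simp: eventually_at_right_field intro: exI[of _ 1])
  have "(growth (closure U) \<longlongrightarrow> ?L) (at_right 0)"
    by (rule tendsto_sandwich[OF lower upper lim3 lim])
  then have "Lim (at_right 0) (growth (closure U)) = Lim (at_right 0) (growth UNIV)"
    using lim by (simp add: tendsto_Lim)
  then show "semigroup_entropy G1 act (closure U) = semigroup_entropy G1 act UNIV"
    by (simp add: semigroup_entropy_def growth_def[abs_def])
qed

end

theorem theorem3p3:
  fixes A :: "('a::metric_space, 'e::real_inner) chart set"
    and met :: "('a, 'e) chart \<Rightarrow> 'a \<Rightarrow> 'e \<Rightarrow> 'e \<Rightarrow> real"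
    and G1 :: "'g::monoid_mult set"
    and act :: "'g \<Rightarrow> 'a \<Rightarrow> 'a"
  assumes "compact_riemannian_manifold A met"
    and "generating_set G1"
    and "continuous_action act"
    and "\<And>g. g \<in> G1 \<Longrightarrow> local_homeomorphism (act g)"
    and "strong_orbital_specification G1 act"
  shows "\<forall>x. entropy_point G1 act x"
proof -
  interpret compact_action G1 act
    using assms(1-3)
    by unfold_locales (simp_all add: compact_riemannian_manifold_def generating_set_def)
  show ?thesis
    using entropy_point_if_specification[OF assms(5)] by blast
qed

end
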